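(* Let $n$ be a nonnegative integer and let $q,a,b,x,y$ be nonzero complex numbers with $|q|<1$ such that no factor occurring in a denominator below vanishes. Then $$\sum_{j=0}^n \sum_{h=0}^{j} \frac{(q^{-2n};q)_{2j}\, (yq;q^2)_j\, (aq/(xy);q^2)_j\,(q^{-2j};q^2)_h\, (xq;q^2)_h\, (y;q^2)_h\,(aq^2/(bx);q^2)_h\; q^{2h+2j}}{(q^2;q^2)_j\, (aq/x;q^2)_j\, (aq^2/y;q^2)_j\, (yq^{2-4n}/a;q^2)_j\, (q^2;q^2)_h\, (aq^2/b;q^2)_h\,(aq^2/x;q^2)_h\, (xyq^{1-2j}/a;q^2)_h}$$ $$= \frac{(aq;q^2)_{2n}\, (aq/(xy);q)_{2n}}{(aq/x;q)_{2n}\, (aq^2/y;q^2)_{2n-1}\, (1-aq^{2n}/y)} \sum_{j=0}^{2n} \frac{ (x;q)_j\, (y;q)_j\, (aq/b;q^2)_j\, (q^{-2n};q)_j\, q^j}{(q;q)_j\, (aq;q^2)_j\, (aq/b;q)_j\, (xyq^{-2n}/a;q)_j}.$$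
   Context: For complex $A$ and base $p$, $(A;p)_m=\prod_{i=0}^{m-1}(1-Ap^i)$ for integers $m\ge 0$ (so $(A;p)_0=1$). In the case $n=0$ the symbol $(A;p)_{-1}$ appears, with the usual convention $(A;p)_{-1}=1/(1-Ap^{-1})$. *)

theory Defs
  imports Complex_Main
begin

(* The negative-index branch is the usual convention
   (A;p)_{-k} = 1 / ((1 - A p^{-1}) ... (1 - A p^{-k}));
   only k = 1 is relevant here, see qpoch_minus_one. *)
definition qpoch :: "complex \<Rightarrow> complex \<Rightarrow> int \<Rightarrow> complex" where
  "qpoch A p m =
     (if 0 \<le> m then (\<Prod>i<nat m. 1 - A * p ^ i)
      else 1 / (\<Prod>i=1..nat (- m). 1 - A / p ^ i))"

lemma qpoch_int [simp]: "qpoch A p (int m) = (\<Prod>i<m. 1 - A * p ^ i)"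
  by (simp add: qpoch_def)

lemma qpoch_minus_one: "qpoch A p (- 1) = 1 / (1 - A / p)"
  by (simp add: qpoch_def)

end

theory Submission
  imports Defs
begin

text \<open>
  Write \<open>p = q\<^sup>2\<close>. Both sides are multiples of the same terminating very-well-poised sum in base \<open>p\<close>,
  with parameters \<open>a; b, x, xq, y, yq, q^(-2n), q^(1-2n)\<close>.
  The double sum arises from it by three steps of the Bailey lemma in base \<open>p\<close>, starting from the
  unit Bailey pair, with the parameter pairs \<open>(b, x)\<close>, \<open>(xq, y)\<close>, \<open>(yq, q^(1-2n))\<close>.
  The single sum arises by one step in base \<open>q\<close> with parameters \<open>(x, y)\<close>, from a Bailey pair
  whose \<open>\<alpha>\<close> vanishes at odd indices, so that its defining relation is a 6-\<open>\<phi>\<close>-5 sum in base \<open>p\<close>.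
  The very-well-poised sum has more poles than the theorem excludes; these are removed by
  continuity in \<open>a\<close>.
\<close>

section \<open>Finite q-shifted factorials over a field\<close>

text \<open>A counterpart of \<open>qpoch\<close> with natural-number length over an arbitrary
  field, so that the algebraic identities can be proved by induction on the length.\<close>

definition qfac :: "'a::field \<Rightarrow> 'a \<Rightarrow> nat \<Rightarrow> 'a" where
  "qfac A p n = (\<Prod>i<n. 1 - A * p ^ i)"

lemma qfac_0 [simp]: "qfac A p 0 = 1"
  by (simp add: qfac_def)

lemma qfac_Suc: "qfac A p (Suc n) = qfac A p n * (1 - A * p ^ n)"
  by (simp add: qfac_def)

lemma qfac_add: "qfac A p (m + n) = qfac A p m * qfac (A * p ^ m) p n"
  by (induction n) (simp_all add: qfac_Suc power_add mult_ac)

lemma qfac_nonzero_iff: "qfac A p n \<noteq> 0 \<longleftrightarrow> (\<forall>i<n. A * p ^ i \<noteq> 1)"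
  by (auto simp: qfac_def)

lemma qfac_nonzero_mono: "qfac A p n \<noteq> 0 \<Longrightarrow> m \<le> n \<Longrightarrow> qfac A p m \<noteq> 0"
  by (auto simp: qfac_nonzero_iff)

lemma qfac_double: "qfac A q (2 * n) = qfac A (q\<^sup>2) n * qfac (A * q) (q\<^sup>2) n"
  by (induction n) (simp_all add: qfac_Suc power_mult [symmetric] mult_ac)

text \<open>Among the exponents 0, ..., m + e - 1 there are e even and m odd ones; sorting the
  factors by parity gives two products in base q^2.\<close>

lemma qfac_interleave:
  assumes "e = m \<or> e = Suc m"
  shows "qfac A q (m + e) = qfac A (q\<^sup>2) e * qfac (A * q) (q\<^sup>2) m"
  using assms qfac_double [of A q m]
  by (auto simp: qfac_Suc mult_2 [symmetric] power_mult [symmetric] mult_ac)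

text \<open>Both sides change by the same factor when j grows by 1. The signs and quadratic powers
  of p that reversal produces above and below cancel in the quotient and leave p^j. This turns the
  kernel of the Bailey lemma into the factors with negative powers of the base that occur in the
  theorem.\<close>

lemma qfac_reverse:
  fixes D p :: "'a::field"
  assumes "j \<le> n" "D \<noteq> 0" "p \<noteq> 0" "qfac p p n \<noteq> 0" "qfac D p n \<noteq> 0"
  shows "qfac D p (n - j) * D ^ j / qfac p p (n - j) =
         qfac D p n / qfac p p n * (qfac (1 / p ^ n) p j * p ^ j / qfac (p / (D * p ^ n)) p j)"
  using assms(1)
proof (induction j)
  case 0
  then show ?case by simp
next
  case (Suc j)
  define m where "m = n - Suc j"
  have n: "n = Suc (m + j)" and nj: "n - j = Suc m" using Suc.prems by (auto simp: m_def)
  have D1: "1 - D * p ^ m \<noteq> 0" "1 - p * p ^ m \<noteq> 0" "qfac p p m \<noteq> 0"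
    using assms(4,5) n by (auto simp: qfac_nonzero_iff) 
  have IH: "qfac D p (Suc m) * D ^ j / qfac p p (Suc m) =
         qfac D p n / qfac p p n * (qfac (1 / p ^ n) p j * p ^ j / qfac (p / (D * p ^ n)) p j)"
    using Suc nj by simp
  \<comment> \<open>The ratios of consecutive terms on the two sides. The factors taken out in facts
    1 and 2, together with p, combine to D.\<close>
  have f: "D * (1 - p * p ^ m) / (1 - D * p ^ m) = 
     p * (1 - 1 / p ^ n * p ^ j) / (1 - p / (D * p ^ n) * p ^ j)"
  proof -
    have 1: "1 - 1 / p ^ n * p ^ j = - (1 - p * p ^ m) / (p * p ^ m)"
      using assms(3) by (simp add: n power_add field_simps)
    have 2: "1 - p / (D * p ^ n) * p ^ j = - (1 - D * p ^ m) / (D * p ^ m)"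
      using assms(2,3) by (simp add: n power_add field_simps)
    show ?thesis unfolding 1 2 using D1 assms(2,3) by (simp add: divide_simps) (simp add: algebra_simps)
  qed
  have "qfac D p m * D ^ Suc j / qfac p p m =
     qfac D p (Suc m) * D ^ j / qfac p p (Suc m) * (D * (1 - p * p ^ m) / (1 - D * p ^ m))"
    using D1 by (simp add: qfac_Suc divide_simps)
  also have "\<dots> = qfac D p n / qfac p p n * (qfac (1 / p ^ n) p (Suc j) * p ^ Suc j / qfac (p / (D * p ^ n)) p (Suc j))"
    unfolding IH f unfolding qfac_Suc by (simp add: mult_ac)
  finally show ?case by (simp add: m_def)
qed

section \<open>The q-Pfaff-Saalschuetz sum\<close>

text \<open>
  The function \<open>G\<close> in the proof is the Wilf--Zeilberger companion of the summand.
\<close>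

lemma q_saalschuetz_step:
  fixes A B D p :: "'a::field"
  assumes p0: "\<And>k. 0 < k \<Longrightarrow> k \<le> Suc N \<Longrightarrow> p ^ k \<noteq> 1" and C: "qfac (A * B * D) p (Suc N) \<noteq> 0"
  defines "t \<equiv> \<lambda>n i. qfac A p i * qfac B p i * qfac D p (n - i) * D ^ i / (qfac p p i * qfac p p (n - i) * qfac (A * B * D) p i)"
  shows "(1 - p ^ Suc N) * (1 - A * B * D * p ^ N) * (\<Sum>i\<le>Suc N. t (Suc N) i) =
         (1 - A * D * p ^ N) * (1 - B * D * p ^ N) * (\<Sum>i\<le>N. t N i)"
proof -
  define G where "G = (\<lambda>i. case i of 0 \<Rightarrow> 0 | Suc k \<Rightarrow>
      - (p ^ (N - k) * D ^ Suc k * qfac A p (Suc k) * qfac B p (Suc k) * qfac D p (N - k)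
         / (qfac p p k * qfac p p (N - k) * qfac (A * B * D) p k)))"
  have pn: "qfac p p k \<noteq> 0" if "k \<le> Suc N" for k
    using that p0[of "Suc _"] by (auto simp: qfac_nonzero_iff)
  have main: "(1 - p ^ Suc N) * (1 - A * B * D * p ^ N) * t (Suc N) i
      - (1 - A * D * p ^ N) * (1 - B * D * p ^ N) * t N i = G (Suc i) - G i" if "i \<le> N" for i
  proof -
    define m where "m = N - i"
    have N: "N = m + i" using that by (simp add: m_def)
    have s: "Suc N - i = Suc m" "N - i = m" "Suc (m + i) - i = Suc m" by (auto simp: N)
    have nz: "qfac p p i \<noteq> 0" "qfac p p m \<noteq> 0" "qfac (A * B * D) p i \<noteq> 0" "1 - p * p ^ m \<noteq> 0"
      using pn[of i] pn[of m] qfac_nonzero_mono[OF C, of i] pn[of "Suc m"] by (auto simp: N qfac_Suc)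
    \<comment> \<open>A common factor of both summands and both values of \<open>G\<close>; what is
      left after dividing by it is the elementary identity \<open>q\<close>.\<close>
    define c where "c = qfac A p i * qfac B p i * qfac D p m * D ^ i / (qfac p p i * qfac p p m * qfac (A * B * D) p i)"
    have t1: "t (Suc N) i = c * (1 - D * p ^ m) / (1 - p * p ^ m)"
      and t2: "t N i = c"
      unfolding t_def s c_def qfac_Suc using nz by (simp_all add: divide_simps)
    have g1: "G (Suc i) = - (p ^ m * D * (1 - A * p ^ i) * (1 - B * p ^ i) * c)"
      unfolding G_def c_def using nz by (simp add: qfac_Suc s)
    \<comment> \<open>For i = 0 the truncated difference \<open>i - 1\<close> does no harm: the
      factor 1 - p^i is zero there, in accordance with \<open>G 0 = 0\<close>.\<close>
    have g0: "G i = - (p * p ^ m * (1 - D * p ^ m) * (1 - p ^ i) * (1 - A * B * D * p ^ (i - 1)) / (1 - p * p ^ m) * c)"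
    proof (cases i)
      case 0
      then show ?thesis by (simp add: G_def)
    next
      case (Suc k)
      have k: "N - k = Suc m" by (simp add: N Suc)
      have nz': "qfac p p k \<noteq> 0" "qfac (A * B * D) p k \<noteq> 0" "1 - p * p ^ k \<noteq> 0" "1 - A * B * D * p ^ k \<noteq> 0"
        using nz unfolding Suc qfac_Suc by auto
      show ?thesis unfolding G_def c_def Suc nat.case k qfac_Suc
        using nz nz' by (simp add: divide_simps)
    qed
    have q: "(1 - p * p ^ m * p ^ i) * (1 - A * B * D * p ^ m * p ^ i) * (1 - D * p ^ m)
       - (1 - A * D * p ^ m * p ^ i) * (1 - B * D * p ^ m * p ^ i) * (1 - p * p ^ m) =
        - (p ^ m * D * (1 - A * p ^ i) * (1 - B * p ^ i)) * (1 - p * p ^ m)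
         + p * p ^ m * (1 - D * p ^ m) * (1 - p ^ i) * (1 - A * B * D * p ^ (i - 1))"
      by (cases i) (simp_all add: algebra_simps)
    have "(1 - p ^ Suc N) * (1 - A * B * D * p ^ N) * t (Suc N) i
      - (1 - A * D * p ^ N) * (1 - B * D * p ^ N) * t N i = c / (1 - p * p ^ m) *
       ((1 - p * p ^ m * p ^ i) * (1 - A * B * D * p ^ m * p ^ i) * (1 - D * p ^ m)
       - (1 - A * D * p ^ m * p ^ i) * (1 - B * D * p ^ m * p ^ i) * (1 - p * p ^ m))"
      unfolding t1 t2 using nz(4) by (simp add: N power_add divide_simps) (simp add: algebra_simps)
    also have "\<dots> = G (Suc i) - G i"
      unfolding q g1 g0 using nz(4) by (simp add: divide_simps) (simp add: algebra_simps)
    finally show ?thesis .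
  qed
  \<comment> \<open>The index \<open>Suc N\<close> is treated apart: because of truncated
    subtraction \<open>t N (Suc N)\<close> need not vanish. This last term cancels the value
    \<open>G (Suc N)\<close> left by telescoping.\<close>
  have last: "(1 - p ^ Suc N) * (1 - A * B * D * p ^ N) * t (Suc N) (Suc N) = - G (Suc N)"
    using pn[of "Suc N"] C by (simp add: t_def G_def qfac_Suc divide_simps)
  have "(\<Sum>i\<le>N. (1 - p ^ Suc N) * (1 - A * B * D * p ^ N) * t (Suc N) i
      - (1 - A * D * p ^ N) * (1 - B * D * p ^ N) * t N i) = (\<Sum>i<Suc N. G (Suc i) - G i)"
    using main by (intro sum.cong) auto
  also have "\<dots> = G (Suc N)" by (simp only: sum_lessThan_telescope) (simp add: G_def)
  finally have "(1 - p ^ Suc N) * (1 - A * B * D * p ^ N) * (\<Sum>i\<le>N. t (Suc N) i)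
      - (1 - A * D * p ^ N) * (1 - B * D * p ^ N) * (\<Sum>i\<le>N. t N i) = G (Suc N)"
    by (simp only: sum_subtractf sum_distrib_left)
  with last show ?thesis
    by (simp only: sum.atMost_Suc distrib_left) (simp only: add_ac diff_eq_eq, simp)
qed

text \<open>The product satisfies the same first-order recurrence in N as the sum, with the same
  value 1 at N = 0. In classical form this is the balanced 3-phi-2 with upper parameters A, B,
  p^(-N) and lower parameters ABD, p^(1-N)/D; the convolution form is the one that arises in the
  Bailey lemma.\<close>

lemma q_saalschuetz:
  fixes A B D p :: "'a::field"
  assumes "\<And>k. 0 < k \<Longrightarrow> k \<le> N \<Longrightarrow> p ^ k \<noteq> 1" and "qfac (A * B * D) p N \<noteq> 0"
  shows "(\<Sum>i\<le>N. qfac A p i * qfac B p i * qfac D p (N - i) * D ^ i / (qfac p p i * qfac p p (N - i) * qfac (A * B * D) p i))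
     = qfac (A * D) p N * qfac (B * D) p N / (qfac p p N * qfac (A * B * D) p N)"
  using assms
proof (induction N)
  case 0
  then show ?case by simp
next
  case (Suc N)
  let ?S = "\<lambda>N. \<Sum>i\<le>N. qfac A p i * qfac B p i * qfac D p (N - i) * D ^ i / (qfac p p i * qfac p p (N - i) * qfac (A * B * D) p i)"
  have nz: "qfac (A * B * D) p N \<noteq> 0" "1 - A * B * D * p ^ N \<noteq> 0" "1 - p * p ^ N \<noteq> 0"
    using Suc.prems(2) Suc.prems(1)[of "Suc N"] by (auto simp: qfac_Suc)
  have solve: "s = k / (u * v)" if "u * v * s = k" "u \<noteq> 0" "v \<noteq> 0" for s k u v :: 'a
    using that by auto
  have "?S N = qfac (A * D) p N * qfac (B * D) p N / (qfac p p N * qfac (A * B * D) p N)"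
    using Suc nz by simp
  with q_saalschuetz_step[OF Suc.prems] have
    "(1 - p ^ Suc N) * (1 - A * B * D * p ^ N) * ?S (Suc N) = (1 - A * D * p ^ N) * (1 - B * D * p ^ N) * 
       (qfac (A * D) p N * qfac (B * D) p N / (qfac p p N * qfac (A * B * D) p N))" by simp
  then have "?S (Suc N) = (1 - A * D * p ^ N) * (1 - B * D * p ^ N) * 
       (qfac (A * D) p N * qfac (B * D) p N / (qfac p p N * qfac (A * B * D) p N)) / ((1 - p ^ Suc N) * (1 - A * B * D * p ^ N))"
    by (rule solve) (use nz in auto)
  also have "\<dots> = qfac (A * D) p (Suc N) * qfac (B * D) p (Suc N) / (qfac p p (Suc N) * qfac (A * B * D) p (Suc N))"
    by (simp add: qfac_Suc mult_ac)
  finally show ?case .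
qed

section \<open>Bailey pairs and the Bailey lemma\<close>

text \<open>
  The truncation at \<open>N\<close> keeps the nondegeneracy conditions finite in number, and it lets a
  parameter of \<open>bailey_pair_step\<close> depend on \<open>N\<close>.
\<close>

definition bailey_pair :: "'a::field \<Rightarrow> 'a \<Rightarrow> nat \<Rightarrow> (nat \<Rightarrow> 'a) \<Rightarrow> (nat \<Rightarrow> 'a) \<Rightarrow> bool" where
  "bailey_pair p a N \<alpha> \<beta> \<longleftrightarrow>
     (\<forall>n\<le>N. \<beta> n = (\<Sum>r\<le>n. \<alpha> r / (qfac p p (n - r) * qfac (a * p) p (n + r))))"

lemma bailey_pairD:
  "bailey_pair p a N \<alpha> \<beta> \<Longrightarrow> n \<le> N \<Longrightarrow>
     \<beta> n = (\<Sum>r\<le>n. \<alpha> r / (qfac p p (n - r) * qfac (a * p) p (n + r)))"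
  by (simp add: bailey_pair_def)

text \<open>The product \<open>\<Prod>i<r. - (p ^ i)\<close> is \<open>(-1)^r p^(r(r-1)/2)\<close>.\<close>

definition unit_alpha :: "'a::field \<Rightarrow> 'a \<Rightarrow> nat \<Rightarrow> 'a" where
  "unit_alpha p a r = (1 - a * p ^ (2 * r)) / (1 - a) * qfac a p r * (\<Prod>i<r. - (p ^ i)) / qfac p p r"

text \<open>For n > 0 the partial sums up to m have a product form with the factor 1 - p^(n-m),
  which vanishes at m = n. The assumption on \<open>a\<close> covers 1 - a in
  \<open>unit_alpha\<close> as well as the factors of (ap; p)_(2N).\<close>

lemma unit_bailey_pair:
  fixes a p :: "'a::field"
  assumes p: "\<And>k. 0 < k \<Longrightarrow> k \<le> N \<Longrightarrow> p ^ k \<noteq> 1" and a: "qfac a p (Suc (2 * N)) \<noteq> 0"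
  shows "bailey_pair p a N (unit_alpha p a) (\<lambda>n. if n = 0 then 1 else 0)"
  unfolding bailey_pair_def
proof (intro allI impI)
  fix n assume n: "n \<le> N"
  have a1: "1 - a \<noteq> 0"
    using a by (auto simp: qfac_nonzero_iff)
  have ap: "qfac (a * p) p k \<noteq> 0" if "k \<le> 2 * N" for k
    using a that unfolding qfac_nonzero_iff by (metis Suc_le_mono le_trans less_eq_Suc_le mult.assoc power_Suc)
  have pn: "qfac p p k \<noteq> 0" if "k \<le> N" for k
    using that p[of "Suc _"] by (auto simp: qfac_nonzero_iff)
  have aSuc: "qfac a p (Suc k) = (1 - a) * qfac (a * p) p k" for k
    using qfac_add[of a p 1 k] by (simp add: qfac_Suc)
  let ?t = "\<lambda>r. unit_alpha p a r / (qfac p p (n - r) * qfac (a * p) p (n + r))"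
  have part: "(\<Sum>r\<le>m. ?t r) = (\<Prod>i<m. - (p ^ i)) * p ^ m * qfac (a * p) p m * (1 - p ^ (n - m)) /
       (qfac p p m * qfac p p (n - m) * qfac (a * p) p (n + m) * (1 - p ^ n))" if "m \<le> n" "0 < n" for m
    using that(1)
  proof (induction m)
    case 0
    then show ?case using a1 p[of n] n that by (simp add: unit_alpha_def divide_simps)
  next
    case (Suc m)
    define k where "k = n - Suc m"
    have nk: "n = Suc (k + m)" and nm: "n - m = Suc k" using Suc.prems by (auto simp: k_def)
    \<comment> \<open>The factors shared by the partial sum and the next term; the induction step
      then reduces to a polynomial identity in a, p, p^k and p^m.\<close>
    define c where "c = (\<Prod>i<m. - (p ^ i)) * p ^ m * qfac (a * p) p m / 
       (qfac p p (Suc m) * qfac p p k * qfac (a * p) p (Suc (n + m)) * (1 - p ^ n))"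
    have nz: "qfac p p m \<noteq> 0" "qfac p p k \<noteq> 0" "1 - p * p ^ m \<noteq> 0" "1 - p * p ^ k \<noteq> 0" "1 - p ^ n \<noteq> 0"
      using pn[of m] pn[of k] p[of "Suc m"] p[of "Suc k"] p[of n] n nk by auto
    have nz2: "qfac (a * p) p (n + m) \<noteq> 0" "1 - a * p * p ^ (n + m) \<noteq> 0"
      using ap[of "n + m"] ap[of "Suc (n + m)"] n nk by (auto simp: qfac_Suc)
    have e1: "(\<Sum>r\<le>m. ?t r) = c * (1 - p * p ^ m) * (1 - a * p * p ^ (n + m))"
    proof -
      have "(\<Sum>r\<le>m. ?t r) = (\<Prod>i<m. - (p ^ i)) * p ^ m * qfac (a * p) p m * (1 - p * p ^ k) /
       (qfac p p m * (qfac p p k * (1 - p * p ^ k)) * qfac (a * p) p (n + m) * (1 - p ^ n))"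
        using Suc nm by (simp add: qfac_Suc)
      also have "\<dots> = c * (1 - p * p ^ m) * (1 - a * p * p ^ (n + m))"
        unfolding c_def qfac_Suc using nz nz2 by (simp add: divide_simps)
      finally show ?thesis .
    qed
    have e2: "?t (Suc m) = - c * (1 - a * p ^ (2 * Suc m)) * (1 - p ^ n)"
      unfolding unit_alpha_def aSuc prod.lessThan_Suc c_def add_Suc_right k_def [symmetric]
      using a1 nz by (simp add: divide_simps)
    have e3: "p ^ n = p * p ^ k * p ^ m" "p ^ (n + m) = p * p ^ k * p ^ m * p ^ m" "p ^ (2 * Suc m) = p * p * p ^ m * p ^ m"
      by (simp_all add: nk power_add mult_2 mult_2_right mult_ac)
    have "(\<Sum>r\<le>Suc m. ?t r) = c * (1 - p * p ^ m) * (1 - a * p * p ^ (n + m)) - c * (1 - a * p ^ (2 * Suc m)) * (1 - p ^ n)"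
      using e1 e2 by simp
    also have "\<dots> = - c * (p * p ^ m) * (1 - a * p * p ^ m) * (1 - p ^ k)"
      unfolding e3 by (simp add: algebra_simps)
    also have "\<dots> = (\<Prod>i<Suc m. - (p ^ i)) * p ^ Suc m * qfac (a * p) p (Suc m) * (1 - p ^ (n - Suc m)) /
       (qfac p p (Suc m) * qfac p p (n - Suc m) * qfac (a * p) p (n + Suc m) * (1 - p ^ n))"
      unfolding c_def k_def [symmetric] add_Suc_right qfac_Suc [of "a * p" p m]
      by (simp add: mult_ac)
    finally show ?case .
  qed
  show "(if n = 0 then 1 else 0) = (\<Sum>r\<le>n. ?t r)"
  proof (cases "n = 0")
    case True
    then show ?thesis using a1 by (simp add: unit_alpha_def)
  next
    case False
    then show ?thesis using part[of n] by simp
  qed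
qed

lemma sum_triangle_shift:
  fixes n :: nat
  shows "(\<Sum>j\<le>n. \<Sum>r\<le>j. g j r) = (\<Sum>r\<le>n. \<Sum>i\<le>n - r. g (r + i) r)"
proof -
  have "(\<Sum>j\<le>n. \<Sum>r\<le>j. g j r) = (\<Sum>(j, r)\<in>(SIGMA j:{..n}. {..j}). g j r)"
    by (rule sum.Sigma) auto
  also have "\<dots> = (\<Sum>(r, i)\<in>(SIGMA r:{..n}. {..n - r}). g (r + i) r)"
    by (rule sum.reindex_bij_witness [where i = "\<lambda>(r, i). (r + i, r)" and j = "\<lambda>(j, r). (r, j - r)"]) auto
  also have "\<dots> = (\<Sum>r\<le>n. \<Sum>i\<le>n - r. g (r + i) r)"
    by (rule sum.Sigma [symmetric]) auto
  finally show ?thesis .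
qed

text \<open>This is the Bailey lemma. The sum for \<beta> j is inserted, the summations are
  interchanged and j = r + i is substituted; the inner sum over i is then a q-Saalschuetz sum, whose
  value gives the new coefficient of \<alpha> r.\<close>

lemma bailey_pair_step:
  fixes a p \<rho>\<^sub>1 \<rho>\<^sub>2 :: "'a::field"
  assumes pair: "bailey_pair p a N \<alpha> \<beta>"
    and p: "\<And>k. 0 < k \<Longrightarrow> k \<le> N \<Longrightarrow> p ^ k \<noteq> 1"
    and \<rho>: "\<rho>\<^sub>1 \<noteq> 0" "\<rho>\<^sub>2 \<noteq> 0"
    and a: "qfac (a * p) p (2 * N) \<noteq> 0" 
    and a\<rho>: "qfac (a * p / \<rho>\<^sub>1) p N \<noteq> 0" "qfac (a * p / \<rho>\<^sub>2) p N \<noteq> 0"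
  defines "D \<equiv> a * p / (\<rho>\<^sub>1 * \<rho>\<^sub>2)"
  shows "bailey_pair p a N
     (\<lambda>r. qfac \<rho>\<^sub>1 p r * qfac \<rho>\<^sub>2 p r * D ^ r / (qfac (a * p / \<rho>\<^sub>1) p r * qfac (a * p / \<rho>\<^sub>2) p r) * \<alpha> r)
     (\<lambda>n. \<Sum>j\<le>n. qfac \<rho>\<^sub>1 p j * qfac \<rho>\<^sub>2 p j * (qfac D p (n - j) * D ^ j / qfac p p (n - j)) * \<beta> j
             / (qfac (a * p / \<rho>\<^sub>1) p n * qfac (a * p / \<rho>\<^sub>2) p n))"
  unfolding bailey_pair_def
proof (intro allI impI)
  fix n assume n: "n \<le> N"
  let ?R = "qfac (a * p / \<rho>\<^sub>1) p n * qfac (a * p / \<rho>\<^sub>2) p n"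
  let ?K = "\<lambda>j. qfac \<rho>\<^sub>1 p j * qfac \<rho>\<^sub>2 p j * (qfac D p (n - j) * D ^ j / qfac p p (n - j)) / ?R"
  have kernel: "(\<Sum>i\<le>n - r. ?K (r + i) * (\<alpha> r / (qfac p p (r + i - r) * qfac (a * p) p (r + i + r)))) =
      qfac \<rho>\<^sub>1 p r * qfac \<rho>\<^sub>2 p r * D ^ r / (qfac (a * p / \<rho>\<^sub>1) p r * qfac (a * p / \<rho>\<^sub>2) p r) * \<alpha> r
      / (qfac p p (n - r) * qfac (a * p) p (n + r))" if "r \<le> n" for r
  proof -
    define M where "M = n - r"
    have nM: "n = r + M" using that by (simp add: M_def)
    \<comment> \<open>The shift by r is absorbed into \<open>A\<close> and \<open>B\<close>, while
      \<open>D\<close> and hence the kernel keep their form. Since ABD = a p^(2r+1), the product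
      (ap; p)_(2r+i) splits into (ap; p)_(2r) and (ABD; p)_i.\<close>
    define A where "A = \<rho>\<^sub>1 * p ^ r"
    define B where "B = \<rho>\<^sub>2 * p ^ r"
    have AD: "A * D = a * p / \<rho>\<^sub>2 * p ^ r" and BD: "B * D = a * p / \<rho>\<^sub>1 * p ^ r"
      and ABD: "A * B * D = a * p * p ^ (2 * r)"
      using \<rho> by (simp_all add: A_def B_def D_def mult_2 power_add)
    have s1: "qfac (a * p) p (r + i + r) = qfac (a * p) p (2 * r) * qfac (A * B * D) p i" for i
      using qfac_add [of "a * p" p "2 * r" i] by (simp add: ABD mult_2 add_ac)
    have s2: "qfac \<rho>\<^sub>1 p (r + i) = qfac \<rho>\<^sub>1 p r * qfac A p i" "qfac \<rho>\<^sub>2 p (r + i) = qfac \<rho>\<^sub>2 p r * qfac B p i" for i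
      by (simp_all add: A_def B_def qfac_add)
    have s3: "qfac (a * p) p (n + r) = qfac (a * p) p (2 * r) * qfac (A * B * D) p M"
      using s1 [of M] by (simp add: nM)
    have s4: "qfac (a * p / \<rho>\<^sub>1) p n = qfac (a * p / \<rho>\<^sub>1) p r * qfac (B * D) p M"
       "qfac (a * p / \<rho>\<^sub>2) p n = qfac (a * p / \<rho>\<^sub>2) p r * qfac (A * D) p M"
      unfolding nM qfac_add AD BD by simp_all
    have nz: "qfac (A * B * D) p M \<noteq> 0" "qfac (B * D) p M \<noteq> 0" "qfac (A * D) p M \<noteq> 0"
      using qfac_nonzero_mono [OF a, of "n + r"] qfac_nonzero_mono [OF a\<rho>(1) n] qfac_nonzero_mono [OF a\<rho>(2) n]
        n that unfolding s3 s4 by auto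
    have "(\<Sum>i\<le>n - r. ?K (r + i) * (\<alpha> r / (qfac p p (r + i - r) * qfac (a * p) p (r + i + r)))) =
      qfac \<rho>\<^sub>1 p r * qfac \<rho>\<^sub>2 p r * D ^ r * \<alpha> r / (?R * qfac (a * p) p (2 * r)) *
      (\<Sum>i\<le>M. qfac A p i * qfac B p i * qfac D p (M - i) * D ^ i / (qfac p p i * qfac p p (M - i) * qfac (A * B * D) p i))"
      unfolding sum_distrib_left M_def [symmetric] s1 s2
      by (intro sum.cong refl) (simp add: nM power_add mult_ac)
    also have "\<dots> = qfac \<rho>\<^sub>1 p r * qfac \<rho>\<^sub>2 p r * D ^ r * \<alpha> r / (?R * qfac (a * p) p (2 * r)) *
      (qfac (A * D) p M * qfac (B * D) p M / (qfac p p M * qfac (A * B * D) p M))"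
      by (subst q_saalschuetz) (use p n nz M_def in auto)
    also have "\<dots> = qfac \<rho>\<^sub>1 p r * qfac \<rho>\<^sub>2 p r * D ^ r / (qfac (a * p / \<rho>\<^sub>1) p r * qfac (a * p / \<rho>\<^sub>2) p r) * \<alpha> r
      / (qfac p p (n - r) * qfac (a * p) p (n + r))"
      unfolding s3 s4 M_def [symmetric] using nz(2,3) by (simp add: mult_ac)
    finally show ?thesis .
  qed
  have "(\<Sum>j\<le>n. qfac \<rho>\<^sub>1 p j * qfac \<rho>\<^sub>2 p j * (qfac D p (n - j) * D ^ j / qfac p p (n - j)) * \<beta> j / ?R) =
     (\<Sum>j\<le>n. \<Sum>r\<le>j. ?K j * (\<alpha> r / (qfac p p (j - r) * qfac (a * p) p (j + r))))"
    unfolding sum_distrib_left [symmetric]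
    using n by (intro sum.cong refl) (simp add: bailey_pairD [OF pair])
  also have "\<dots> = (\<Sum>r\<le>n. \<Sum>i\<le>n - r. ?K (r + i) * (\<alpha> r / (qfac p p (r + i - r) * qfac (a * p) p (r + i + r))))"
    by (rule sum_triangle_shift)
  also have "\<dots> = (\<Sum>r\<le>n. qfac \<rho>\<^sub>1 p r * qfac \<rho>\<^sub>2 p r * D ^ r / (qfac (a * p / \<rho>\<^sub>1) p r * qfac (a * p / \<rho>\<^sub>2) p r) * \<alpha> r
      / (qfac p p (n - r) * qfac (a * p) p (n + r)))"
    by (intro sum.cong refl kernel) simp
  finally show "(\<Sum>j\<le>n. qfac \<rho>\<^sub>1 p j * qfac \<rho>\<^sub>2 p j * (qfac D p (n - j) * D ^ j / qfac p p (n - j)) * \<beta> j / ?R) = \<dots>" .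
qed


text \<open>One step of the Bailey lemma from the unit pair: only j = 0 survives in the sum for the
  new \<beta>. The defining relation of the resulting pair is the terminating 6-phi-5 sum.\<close>

lemma six_phi_five_bailey_pair:
  fixes a b c p :: "'a::field"
  assumes p: "\<And>k. 0 < k \<Longrightarrow> k \<le> N \<Longrightarrow> p ^ k \<noteq> 1"
    and bc: "b \<noteq> 0" "c \<noteq> 0"
    and a: "qfac a p (Suc (2 * N)) \<noteq> 0" 
    and abc: "qfac (a * p / b) p N \<noteq> 0" "qfac (a * p / c) p N \<noteq> 0"
  shows "bailey_pair p a N
     (\<lambda>r. qfac b p r * qfac c p r * (a * p / (b * c)) ^ r / (qfac (a * p / b) p r * qfac (a * p / c) p r) * unit_alpha p a r)
     (\<lambda>n. qfac (a * p / (b * c)) p n / (qfac p p n * qfac (a * p / b) p n * qfac (a * p / c) p n))"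
proof -
  have ap: "qfac (a * p) p (2 * N) \<noteq> 0"
    using a qfac_add [of a p 1 "2 * N"] by auto
  have eq: "(\<Sum>j\<le>n. qfac b p j * qfac c p j * (qfac D p (n - j) * D ^ j / qfac p p (n - j)) * (if j = 0 then 1 else 0)
             / (qfac (a * p / b) p n * qfac (a * p / c) p n)) = qfac D p n / (qfac p p n * qfac (a * p / b) p n * qfac (a * p / c) p n)"
     for n D
    by (subst sum.mono_neutral_right [where S = "{0}"]) auto
  show ?thesis
    using bailey_pair_step [OF unit_bailey_pair [OF p a] p bc ap abc] unfolding eq by simp
qed

section \<open>The Bailey pair in base q supported on even indices\<close>

text \<open>Each of the last s factors of (q; q^2)_e is, up to sign and a power of q, a factor of
  (q^(1-2e); q^2)_s. The products stay on both sides, so that they may vanish.\<close>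

lemma qfac_reflect:
  fixes q :: "'a::field"
  assumes "q \<noteq> 0" "s \<le> e"
  shows "qfac (q / q ^ (2 * e)) (q\<^sup>2) s * (q ^ (2 * e + 1)) ^ s * qfac q (q\<^sup>2) (e - s) =
     (- 1) ^ s * q ^ (s * s + s) * qfac q (q\<^sup>2) e"
  using assms(2)
proof (induction s)
  case 0
  then show ?case by simp
next
  case (Suc s)
  define m where "m = e - Suc s"
  have e: "e = Suc m + s" and es: "e - s = Suc m" using Suc.prems by (auto simp: m_def)
  have f: "(1 - q / q ^ (2 * e) * (q\<^sup>2) ^ s) * q ^ (2 * e + 1) = - (1 - q * (q\<^sup>2) ^ m) * q ^ (2 * s + 2)"
    using assms(1) by (simp add: e field_simps power_add power_mult power2_eq_square)
  have "qfac (q / q ^ (2 * e)) (q\<^sup>2) (Suc s) * (q ^ (2 * e + 1)) ^ Suc s * qfac q (q\<^sup>2) m =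
    qfac (q / q ^ (2 * e)) (q\<^sup>2) s * (q ^ (2 * e + 1)) ^ s * qfac q (q\<^sup>2) m *
    ((1 - q / q ^ (2 * e) * (q\<^sup>2) ^ s) * q ^ (2 * e + 1))"
    by (simp add: qfac_Suc mult_ac)
  also have "\<dots> = - (qfac (q / q ^ (2 * e)) (q\<^sup>2) s * (q ^ (2 * e + 1)) ^ s * qfac q (q\<^sup>2) (Suc m)) * q ^ (2 * s + 2)"
    unfolding f qfac_Suc by (simp add: algebra_simps)
  also have "\<dots> = - ((- 1) ^ s * q ^ (s * s + s) * qfac q (q\<^sup>2) e) * q ^ (2 * s + 2)"
    using Suc es by simp
  also have "\<dots> = (- 1) ^ Suc s * q ^ (Suc s * Suc s + Suc s) * qfac q (q\<^sup>2) e"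
    by (simp add: power_add mult_2 mult_2_right mult_ac)
  finally show ?case by (simp add: m_def)
qed

text \<open>The entry at 2s is the limit, as c tends to infinity, of the \<alpha> of
  \<open>six_phi_five_bailey_pair\<close> in base q^2: the sign and the power of q are what remains
  of (c; q^2)_s (a q^2 / (bc))^s.\<close>

definition quad_alpha :: "'a::field \<Rightarrow> 'a \<Rightarrow> 'a \<Rightarrow> nat \<Rightarrow> 'a" where
  "quad_alpha q a b r = (if even r then
     unit_alpha (q\<^sup>2) a (r div 2) * qfac b (q\<^sup>2) (r div 2) / qfac (a * q\<^sup>2 / b) (q\<^sup>2) (r div 2)
       * (a / b) ^ (r div 2) * (- 1) ^ (r div 2) * q ^ (r div 2 * (r div 2) + r div 2)
     else 0)"

text \<open>
  The cases \<open>e = m\<close> and \<open>e = Suc m\<close> are the even and the odd index \<open>m + e\<close> of the pair in base \<open>q\<close>.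
\<close>

lemma quad_alpha_term:
  fixes a b q :: "'a::field"
  assumes s: "s \<le> m" and e: "e = m \<or> e = Suc m" and q: "q \<noteq> 0" and nz: "qfac q (q\<^sup>2) e \<noteq> 0"
  defines "c \<equiv> q / q ^ (2 * e)" and "p \<equiv> q\<^sup>2"
  shows "quad_alpha q a b (2 * s) / (qfac q q (m + e - 2 * s) * qfac (a * q) q (m + e + 2 * s)) =
    qfac b p s * qfac c p s * (a * p / (b * c)) ^ s / (qfac (a * p / b) p s * qfac (a * p / c) p s) * unit_alpha p a s
      / (qfac p p (m - s) * qfac (a * p) p (m + s)) / (qfac q p e * qfac (a * q) p e)"
proof -
  have "qfac q q ((m - s) + (e - s)) = qfac q (q\<^sup>2) (e - s) * qfac (q * q) (q\<^sup>2) (m - s)"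
    by (rule qfac_interleave) (use s e in auto)
  then have 1: "qfac q q (m + e - 2 * s) = qfac q p (e - s) * qfac p p (m - s)"
    using s e by (auto simp: p_def power2_eq_square [of q] mult_2)
  \<comment> \<open>The choice c = q^(1-2e) makes (ap/c; p)_s the continuation of (aq; p)_e to (aq;
    p)_(e+s).\<close>
  have apc: "a * p / c = a * q * p ^ e"
    using q by (simp add: p_def c_def power2_eq_square power_mult)
  have "qfac (a * q) q ((m + s) + (e + s)) = qfac (a * q) (q\<^sup>2) (e + s) * qfac (a * q * q) (q\<^sup>2) (m + s)"
    by (rule qfac_interleave) (use e in auto)
  moreover have "m + e + 2 * s = (m + s) + (e + s)" "a * q * q = a * q\<^sup>2"
    by (simp, simp only: power2_eq_square mult.assoc)
  ultimately have 2: "qfac (a * q) q (m + e + 2 * s) = qfac (a * q) p e * qfac (a * p / c) p s * qfac (a * p) p (m + s)"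
    unfolding apc by (simp only: p_def qfac_add [of "a * q" "q\<^sup>2" e s])
  have 3: "(a * p / (b * c)) ^ s = (a / b) ^ s * (q ^ (2 * e + 1)) ^ s"
    using q by (simp add: p_def c_def power2_eq_square power_mult_distrib [symmetric] power_divide [symmetric])
  have "qfac q p (e - s) \<noteq> 0"
    using qfac_nonzero_mono [OF nz, of "e - s"] by (simp add: p_def)
  \<comment> \<open>Reflection trades the sign and the quadratic power in \<open>quad_alpha\<close>
    for the numerator factor (c; p)_s, and (q; p)_(e-s) for (q; p)_e.\<close>
  then have 4: "(- 1) ^ s * q ^ (s * s + s) / qfac q p (e - s) = qfac c p s * (q ^ (2 * e + 1)) ^ s / qfac q p e"
    using qfac_reflect [OF q, of s e] s e nz by (auto simp: c_def p_def frac_eq_eq mult_ac)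
  have "quad_alpha q a b (2 * s) / (qfac q q (m + e - 2 * s) * qfac (a * q) q (m + e + 2 * s)) =
    unit_alpha p a s * qfac b p s / qfac (a * p / b) p s * (a / b) ^ s * ((- 1) ^ s * q ^ (s * s + s) / qfac q p (e - s))
     / (qfac p p (m - s) * (qfac (a * q) p e * qfac (a * p / c) p s * qfac (a * p) p (m + s)))"
    unfolding 1 2 by (simp add: quad_alpha_def p_def mult_ac)
  also have "\<dots> = qfac b p s * qfac c p s * (a * p / (b * c)) ^ s / (qfac (a * p / b) p s * qfac (a * p / c) p s) * unit_alpha p a s
      / (qfac p p (m - s) * qfac (a * p) p (m + s)) / (qfac q p e * qfac (a * q) p e)"
    unfolding 3 4 by (simp add: mult_ac)
  finally show ?thesis .
qed

lemma sum_even: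
  fixes f :: "nat \<Rightarrow> 'a::comm_monoid_add"
  assumes "\<And>r. odd r \<Longrightarrow> f r = 0"
  shows "(\<Sum>r\<le>j. f r) = (\<Sum>s\<le>j div 2. f (2 * s))"
proof -
  have "(\<Sum>r\<le>j. f r) = (\<Sum>r\<in>{r. r \<le> j \<and> even r}. f r)"
    by (rule sum.mono_neutral_right) (use assms in auto)
  also have "\<dots> = (\<Sum>s\<le>j div 2. f (2 * s))"
    by (rule sum.reindex_bij_witness [where i = "\<lambda>s. 2 * s" and j = "\<lambda>r. r div 2"]) auto
  finally show ?thesis .
qed

text \<open>With j = m + e the terms of odd index vanish, and the rest is the 6-phi-5 sum of index m
  in base q^2 with c = q^(1-2e). Since c varies with j, each j uses its own pair, truncated at
  m.\<close>

lemma quad_bailey_pair: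
  fixes a b q :: "'a::field"
  assumes q0: "q \<noteq> 0" and b0: "b \<noteq> 0" and q: "\<And>k. 0 < k \<Longrightarrow> q ^ k \<noteq> 1"
    and a: "qfac a q (Suc (4 * n)) \<noteq> 0" and ab: "qfac (a * q / b) q (4 * n) \<noteq> 0"
  shows "bailey_pair q a (2 * n) (quad_alpha q a b)
    (\<lambda>j. qfac (a * q / b) (q\<^sup>2) j / (qfac q q j * qfac (a * q / b) q j * qfac (a * q) (q\<^sup>2) j))"
  unfolding bailey_pair_def
proof (intro allI impI)
  fix j assume j: "j \<le> 2 * n"
  define m where "m = j div 2"
  define e where "e = (j + 1) div 2"
  define c where "c = q / q ^ (2 * e)"
  define p where "p = q\<^sup>2"
  define B where "B = a * q / b"
  have e: "e = m \<or> e = Suc m" and jme: "j = m + e" by (auto simp: m_def e_def)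
  have pk: "p ^ k = q ^ (2 * k)" for k by (simp add: p_def power_mult)
  have apc: "a * p / c = a * q * p ^ e" and apb: "a * p / b = B * q" and D: "a * p / (b * c) = B * p ^ e"
    using q0 by (simp_all add: p_def c_def B_def power2_eq_square power_mult)
  have an: "a * q ^ k \<noteq> 1" if "k \<le> 4 * n" for k
    using a that by (auto simp: qfac_nonzero_iff)
  have Bn: "B * q ^ k \<noteq> 1" if "k < 4 * n" for k
    using ab that by (auto simp: qfac_nonzero_iff B_def)
  have p1: "p ^ k \<noteq> 1" if "0 < k" for k using q [of "2 * k"] that by (simp add: pk)
  have nz: "qfac q p e \<noteq> 0" 
    using q [of "Suc _"] by (auto simp: qfac_nonzero_iff pk)
  have nzB: "qfac B p e \<noteq> 0"
    using Bn j jme by (auto simp: qfac_nonzero_iff pk)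
  have nzBq: "qfac (a * p / b) p m \<noteq> 0"
    unfolding apb using Bn [of "Suc _"] j jme e by (auto simp: qfac_nonzero_iff pk mult.assoc)
  have nza: "qfac a p (Suc (2 * m)) \<noteq> 0"
    using an [of "2 * _"] j m_def by (auto simp: qfac_nonzero_iff pk)
  have nzaq: "qfac (a * p / c) p m \<noteq> 0"
    unfolding apc using an [of "Suc (2 * e + 2 * _)"] j jme
    by (auto simp: qfac_nonzero_iff pk mult.assoc power_add)
  have c0: "c \<noteq> 0" using q0 by (simp add: c_def)
  have "(\<Sum>r\<le>j. quad_alpha q a b r / (qfac q q (j - r) * qfac (a * q) q (j + r))) =
     (\<Sum>s\<le>m. quad_alpha q a b (2 * s) / (qfac q q (m + e - 2 * s) * qfac (a * q) q (m + e + 2 * s)))"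
    unfolding m_def by (subst sum_even) (auto simp: quad_alpha_def jme [unfolded m_def, symmetric])
  also have "\<dots> = (\<Sum>s\<le>m. qfac b p s * qfac c p s * (a * p / (b * c)) ^ s / (qfac (a * p / b) p s * qfac (a * p / c) p s) * unit_alpha p a s
      / (qfac p p (m - s) * qfac (a * p) p (m + s)) / (qfac q p e * qfac (a * q) p e))"
    unfolding p_def c_def by (intro sum.cong refl quad_alpha_term) (use e q0 nz p_def in auto)
  also have "\<dots> = qfac (B * p ^ e) p m / (qfac p p m * qfac (B * q) p m * qfac (a * q * p ^ e) p m) / (qfac q p e * qfac (a * q) p e)"
    using bailey_pairD [OF six_phi_five_bailey_pair [OF p1 b0 c0 nza nzBq nzaq], of m]
    unfolding sum_divide_distrib [symmetric] D apb apc by simp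
  \<comment> \<open>The pieces of lengths e and m recombine to length j; (B; p)_e enters both above
    and below and cancels.\<close>
  also have "\<dots> = qfac B p j / (qfac q q j * qfac B q j * qfac (a * q) p j)"
  proof -
    have "qfac q q j = qfac q p e * qfac p p m" "qfac B q j = qfac B p e * qfac (B * q) p m"
      unfolding jme p_def using qfac_interleave [OF e] by (simp_all add: power2_eq_square)
    moreover have "qfac B p j = qfac B p e * qfac (B * p ^ e) p m" "qfac (a * q) p j = qfac (a * q) p e * qfac (a * q * p ^ e) p m"
      unfolding jme by (simp_all add: add.commute [of m e] qfac_add)
    ultimately show ?thesis using nzB by (simp add: mult_ac)
  qed
  finally show "qfac (a * q / b) (q\<^sup>2) j / (qfac q q j * qfac (a * q / b) q j * qfac (a * q) (q\<^sup>2) j)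
     = (\<Sum>r\<le>j. quad_alpha q a b r / (qfac q q (j - r) * qfac (a * q) q (j + r)))"
    by (simp add: B_def p_def)
qed


section \<open>Both sides as multiples of one very-well-poised sum, for generic a\<close>

text \<open>The assumption \<open>gen\<close> keeps a away from the poles of the very-well-poised
  sum \<open>V\<close>. The third pair in base p, read at index n, relates \<open>V\<close> to the
  double sum; the pair in base q after one step, read at index 2n, relates \<open>V\<close> to the
  single sum.\<close>

lemma double_sum_transformation_generic:
  fixes a b x y q :: "'a::field"
  assumes q0: "q \<noteq> 0" and a0: "a \<noteq> 0" and b0: "b \<noteq> 0" and x0: "x \<noteq> 0" and y0: "y \<noteq> 0"
    and q: "\<And>k. 0 < k \<Longrightarrow> q ^ k \<noteq> 1"
    and gen: "\<And>k c. k \<le> 4 * n + 4 \<Longrightarrow> c \<in> {1, 1 / b, 1 / x, 1 / y, 1 / (x * y)} \<Longrightarrow> a * c * q ^ k \<noteq> 1"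
  defines "p \<equiv> q\<^sup>2"
  shows "(\<Sum>j\<le>n. \<Sum>h\<le>j.
        (qfac (1 / q ^ (2 * n)) q (2 * j) * qfac (y * q) p j * qfac (a * q / (x * y)) p j *
         qfac (1 / q ^ (2 * j)) p h * qfac (x * q) p h * qfac y p h * qfac (a * p / (b * x)) p h * q ^ (2 * h + 2 * j)) /
        (qfac p p j * qfac (a * q / x) p j * qfac (a * p / y) p j * qfac (y * (p / q ^ (4 * n)) / a) p j *
         qfac p p h * qfac (a * p / b) p h * qfac (a * p / x) p h * qfac (x * y * (q / q ^ (2 * j)) / a) p h)) =
     qfac (a * q) p (2 * n) * qfac (a * q / (x * y)) q (2 * n) /
       (qfac (a * q / x) q (2 * n) * (qfac (a * p / y) p n * qfac (a * q ^ (2 * n) / y) p n)) *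
     (\<Sum>j\<le>2 * n. (qfac x q j * qfac y q j * qfac (a * q / b) p j * qfac (1 / q ^ (2 * n)) q j * q ^ j) /
          (qfac q q j * qfac (a * q) p j * qfac (a * q / b) q j * qfac (x * y * (1 / q ^ (2 * n)) / a) q j))"
    (is "?L = _ * ?S")
proof -
  have pk: "p ^ k = q ^ (2 * k)" for k by (simp add: p_def power_mult)
  have p0: "p \<noteq> 0" using q0 by (simp add: p_def)
  have p1: "p ^ k \<noteq> 1" if "0 < k" for k using q [of "2 * k"] that by (simp add: pk)
  have ppn: "qfac p p k \<noteq> 0" for k 
    using p1 [of "Suc _"] by (auto simp: qfac_nonzero_iff)
  have qqn: "qfac q q k \<noteq> 0" for k
    using q [of "Suc _"] by (auto simp: qfac_nonzero_iff)
  have qpn: "qfac q p k \<noteq> 0" for k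
    using q [of "Suc _"] by (auto simp: qfac_nonzero_iff pk)
  have gp: "qfac A p m \<noteq> 0" if "A = a * c * q ^ i" "c \<in> {1, 1 / b, 1 / x, 1 / y, 1 / (x * y)}" "i + 2 * m \<le> 4 * n + 6" for A c i m
    using gen [OF _ that(2), of "i + 2 * _"] that(1,3)
    by (auto simp: qfac_nonzero_iff pk power_add mult.assoc)
  have gq: "qfac A q m \<noteq> 0" if "A = a * c * q ^ i" "c \<in> {1, 1 / b, 1 / x, 1 / y, 1 / (x * y)}" "i + m \<le> 4 * n + 5" for A c i m
    using gen [OF _ that(2), of "i + _"] that(1,3)
    by (auto simp: qfac_nonzero_iff power_add mult.assoc)
  \<comment> \<open>The last Bailey parameter q^(1-2n). Each of \<open>D1\<close>,
    \<open>D2\<close>, \<open>D3\<close> is ap divided by the product of the two parameters of one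
    of the three steps.\<close>
  define \<rho> where "\<rho> = q / q ^ (2 * n)"
  define D1 where "D1 = a * p / (b * x)"
  define D2 where "D2 = a * p / (x * q * y)"
  define D3 where "D3 = a * p / (y * q * \<rho>)"
  have \<rho>0: "\<rho> \<noteq> 0" using q0 by (simp add: \<rho>_def)
  have D2: "D2 = a * q / (x * y)" and D3: "D3 = a * q ^ (2 * n) / y"
    using q0 by (simp_all add: D2_def D3_def \<rho>_def p_def power2_eq_square)
  have D20: "D2 \<noteq> 0" "D3 \<noteq> 0" using q0 a0 x0 y0 by (simp_all add: D2 D3)
  have apxq: "a * p / (x * q) = a * q / x" and apyq: "a * p / (y * q) = a * q / y"
    and ap\<rho>: "a * p / \<rho> = a * q * q ^ (2 * n)"
    using q0 by (simp_all add: \<rho>_def p_def power2_eq_square)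
  have nz: "qfac a p (Suc (2 * n)) \<noteq> 0" "qfac (a * p) p (2 * n) \<noteq> 0"
    "qfac (a * p / b) p n \<noteq> 0" "qfac (a * p / x) p n \<noteq> 0" "qfac (a * p / y) p n \<noteq> 0"
    "qfac (a * p / (x * q)) p n \<noteq> 0" "qfac (a * p / (y * q)) p n \<noteq> 0" "qfac (a * p / \<rho>) p n \<noteq> 0"
    using gp [of _ 1 0] gp [of _ 1 2] gp [of _ "1 / b" 2] gp [of _ "1 / x" 2] gp [of _ "1 / y" 2]
      gp [of _ "1 / x" 1] gp [of _ "1 / y" 1] gp [of _ 1 "2 * n + 1"]
    unfolding apxq apyq ap\<rho> by (simp_all add: p_def mult.assoc)
  have D3n: "qfac D3 p n \<noteq> 0"
    using gp [of _ "1 / y" "2 * n"] by (simp add: D3)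
  have D2n: "qfac D2 p j \<noteq> 0" if "j \<le> n" for j
    using gp [of _ "1 / (x * y)" 1] that by (simp add: D2)
  \<comment> \<open>Since \<open>?b1\<close> is a product, the chain of three steps leaves only two
    summations in \<open>?b3\<close>: these form the double sum.\<close>
  let ?b1 = "\<lambda>h. qfac D1 p h / (qfac p p h * qfac (a * p / b) p h * qfac (a * p / x) p h)"
  let ?b2 = "\<lambda>j. \<Sum>h\<le>j. qfac (x * q) p h * qfac y p h * (qfac D2 p (j - h) * D2 ^ h / qfac p p (j - h)) * ?b1 h
             / (qfac (a * p / (x * q)) p j * qfac (a * p / y) p j)"
  let ?b3 = "\<lambda>m. \<Sum>j\<le>m. qfac (y * q) p j * qfac \<rho> p j * (qfac D3 p (m - j) * D3 ^ j / qfac p p (m - j)) * ?b2 j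
             / (qfac (a * p / (y * q)) p m * qfac (a * p / \<rho>) p m)"
  let ?a1 = "\<lambda>r. qfac b p r * qfac x p r * D1 ^ r / (qfac (a * p / b) p r * qfac (a * p / x) p r) * unit_alpha p a r"
  let ?a2 = "\<lambda>r. qfac (x * q) p r * qfac y p r * D2 ^ r / (qfac (a * p / (x * q)) p r * qfac (a * p / y) p r) * ?a1 r"
  let ?a3 = "\<lambda>r. qfac (y * q) p r * qfac \<rho> p r * D3 ^ r / (qfac (a * p / (y * q)) p r * qfac (a * p / \<rho>) p r) * ?a2 r"
  have P1: "bailey_pair p a n ?a1 ?b1"
    unfolding D1_def by (rule six_phi_five_bailey_pair) (use p1 b0 x0 nz in auto)
  have P2: "bailey_pair p a n ?a2 ?b2"
    unfolding D2_def by (rule bailey_pair_step [OF P1]) (use p1 q0 x0 y0 nz in auto)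
  have P3: "bailey_pair p a n ?a3 ?b3"
    unfolding D3_def by (rule bailey_pair_step [OF P2]) (use p1 q0 x0 y0 \<rho>0 nz in auto)
  define V where "V = (\<Sum>r\<le>n. ?a3 r / (qfac p p (n - r) * qfac (a * p) p (n + r)))"

  have b2: "?b2 j = qfac D2 p j / qfac p p j / (qfac (a * q / x) p j * qfac (a * p / y) p j) * 
     (\<Sum>h\<le>j. qfac (x * q) p h * qfac y p h * (qfac (1 / q ^ (2 * j)) p h * q ^ (2 * h) / qfac (x * y * (q / q ^ (2 * j)) / a) p h) * ?b1 h)"
    if "j \<le> n" for j
  proof -
    have "p / (D2 * p ^ j) = x * y * (q / q ^ (2 * j)) / a"
      using q0 by (simp add: D2 pk) (simp add: p_def power2_eq_square mult_ac)
    with qfac_reverse [OF _ D20(1) p0 ppn D2n [OF that]]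
    have "qfac D2 p (j - h) * D2 ^ h / qfac p p (j - h) =
       qfac D2 p j / qfac p p j * (qfac (1 / q ^ (2 * j)) p h * q ^ (2 * h) / qfac (x * y * (q / q ^ (2 * j)) / a) p h)" if "h \<le> j" for h
      using that by (simp add: pk)
    then show ?thesis
      unfolding sum_distrib_left apxq by (intro sum.cong refl) (simp add: mult_ac)
  qed
  have b3: "?b3 n = qfac D3 p n / (qfac p p n * qfac (a * q / y) p n * qfac (a * q * q ^ (2 * n)) p n) * ?L"
  proof -
    have "q ^ (4 * n) = q ^ (2 * n) * q ^ (2 * n)"
      by (simp flip: power_add)
    then have "p / (D3 * p ^ n) = y * (p / q ^ (4 * n)) / a"
      using q0 by (simp add: D3 pk mult_ac)
    with qfac_reverse [OF _ D20(2) p0 ppn D3n]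
    have R: "qfac D3 p (n - j) * D3 ^ j / qfac p p (n - j) =
       qfac D3 p n / qfac p p n * (qfac (1 / q ^ (2 * n)) p j * q ^ (2 * j) / qfac (y * (p / q ^ (4 * n)) / a) p j)" if "j \<le> n" for j
      using that by (simp add: pk)
    \<comment> \<open>The factor (q^(-2n); p)_j comes from the reversal and (\<rho>; p)_j from the
      Bailey parameter; together they form (q^(-2n); q)_(2j).\<close>
    have dbl: "qfac (1 / q ^ (2 * n)) q (2 * j) = qfac (1 / q ^ (2 * n)) p j * qfac \<rho> p j" for j
      by (simp add: qfac_double p_def \<rho>_def)
    show ?thesis
      unfolding apyq ap\<rho> sum_distrib_left [of _ _ "{..n}"]
    proof (intro sum.cong refl)
      fix j assume "j \<in> {..n}"
      then have j: "j \<le> n" by simp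
      show "qfac (y * q) p j * qfac \<rho> p j * (qfac D3 p (n - j) * D3 ^ j / qfac p p (n - j)) * ?b2 j
             / (qfac (a * q / y) p n * qfac (a * q * q ^ (2 * n)) p n) =
         qfac D3 p n / (qfac p p n * qfac (a * q / y) p n * qfac (a * q * q ^ (2 * n)) p n) *
        (\<Sum>h\<le>j. (qfac (1 / q ^ (2 * n)) q (2 * j) * qfac (y * q) p j * qfac (a * q / (x * y)) p j *
         qfac (1 / q ^ (2 * j)) p h * qfac (x * q) p h * qfac y p h * qfac (a * p / (b * x)) p h * q ^ (2 * h + 2 * j)) /
        (qfac p p j * qfac (a * q / x) p j * qfac (a * p / y) p j * qfac (y * (p / q ^ (4 * n)) / a) p j *
         qfac p p h * qfac (a * p / b) p h * qfac (a * p / x) p h * qfac (x * y * (q / q ^ (2 * j)) / a) p h))"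
        unfolding b2 [OF j] R [OF j] dbl sum_distrib_left sum_divide_distrib
        by (intro sum.cong refl) (simp add: D1_def D2 power_add mult_ac)
    qed
  qed
  let ?Q = "\<lambda>j. qfac (a * q / b) (q\<^sup>2) j / (qfac q q j * qfac (a * q / b) q j * qfac (a * q) (q\<^sup>2) j)"
  have nzq: "qfac a q (Suc (4 * n)) \<noteq> 0" "qfac (a * q / b) q (4 * n) \<noteq> 0" "qfac (a * q) q (2 * (2 * n)) \<noteq> 0"
    "qfac (a * q / x) q (2 * n) \<noteq> 0" "qfac (a * q / y) q (2 * n) \<noteq> 0" "qfac (a * q / (x * y)) q (2 * n) \<noteq> 0"
    using gq [of _ 1 0] gq [of _ 1 1] gq [of _ "1 / b" 1] gq [of _ "1 / x" 1] gq [of _ "1 / y" 1]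
      gq [of _ "1 / (x * y)" 1] by simp_all
  have P: "bailey_pair q a (2 * n) (quad_alpha q a b) ?Q"
    by (rule quad_bailey_pair) (use q0 b0 q nzq in auto)
  \<comment> \<open>The Bailey step with parameters x, y at index 2n. On the right only r = 2s with
    s \<le> n contributes.\<close>
  have "(\<Sum>j\<le>2 * n. qfac x q j * qfac y q j * (qfac (a * q / (x * y)) q (2 * n - j) * (a * q / (x * y)) ^ j / qfac q q (2 * n - j)) * ?Q j
             / (qfac (a * q / x) q (2 * n) * qfac (a * q / y) q (2 * n))) =
     (\<Sum>r\<le>2 * n. qfac x q r * qfac y q r * (a * q / (x * y)) ^ r / (qfac (a * q / x) q r * qfac (a * q / y) q r) * quad_alpha q a b r
        / (qfac q q (2 * n - r) * qfac (a * q) q (2 * n + r)))"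
    by (rule bailey_pairD [OF bailey_pair_step [OF P]]) (use q x0 y0 nzq in auto)
  also have "\<dots> = (\<Sum>s\<le>n. qfac x q (2 * s) * qfac y q (2 * s) * (a * q / (x * y)) ^ (2 * s) / (qfac (a * q / x) q (2 * s) * qfac (a * q / y) q (2 * s)) *
      (quad_alpha q a b (2 * s) / (qfac q q (n + n - 2 * s) * qfac (a * q) q (n + n + 2 * s))))"
    by (subst sum_even) (auto simp: quad_alpha_def mult_2 mult.assoc)
  also have "\<dots> = V / (qfac q p n * qfac (a * q) p n)"
    unfolding V_def sum_divide_distrib
  proof (intro sum.cong refl)
    fix s assume "s \<in> {..n}"
    then have s: "s \<le> n" by simp
    \<comment> \<open>For m = e = n the parameter c of \<open>quad_alpha_term\<close> is \<rho>, and
      the powers from the step in base q agree with those from the three steps in base p.\<close>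
    have "a * p / (b * \<rho>) * (a * q / (x * y)) ^ 2 = D1 * D2 * D3"
      using q0 by (simp add: D1_def D2 D3_def p_def power2_eq_square mult_ac)
    then have pow: "(a * p / (b * \<rho>)) ^ s * (a * q / (x * y)) ^ (2 * s) = D1 ^ s * D2 ^ s * D3 ^ s"
      by (simp only: power_mult power_mult_distrib [symmetric])
    have d: "qfac x q (2 * s) = qfac x p s * qfac (x * q) p s" "qfac y q (2 * s) = qfac y p s * qfac (y * q) p s"
      "qfac (a * q / x) q (2 * s) = qfac (a * p / (x * q)) p s * qfac (a * p / x) p s"
      "qfac (a * q / y) q (2 * s) = qfac (a * p / (y * q)) p s * qfac (a * p / y) p s"
      unfolding apxq apyq p_def qfac_double by (simp_all add: power2_eq_square mult_ac)
    have "qfac x q (2 * s) * qfac y q (2 * s) * (a * q / (x * y)) ^ (2 * s) / (qfac (a * q / x) q (2 * s) * qfac (a * q / y) q (2 * s)) *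
      (quad_alpha q a b (2 * s) / (qfac q q (n + n - 2 * s) * qfac (a * q) q (n + n + 2 * s))) =
      ((a * p / (b * \<rho>)) ^ s * (a * q / (x * y)) ^ (2 * s)) * 
      (qfac x q (2 * s) * qfac y q (2 * s) / (qfac (a * q / x) q (2 * s) * qfac (a * q / y) q (2 * s)) *
      (qfac b p s * qfac \<rho> p s / (qfac (a * p / b) p s * qfac (a * p / \<rho>) p s) * unit_alpha p a s
      / (qfac p p (n - s) * qfac (a * p) p (n + s)) / (qfac q p n * qfac (a * q) p n)))"
      unfolding p_def \<rho>_def by (subst quad_alpha_term) (use s q0 qpn p_def in auto)
    also have "\<dots> = ?a3 s / (qfac p p (n - s) * qfac (a * p) p (n + s)) / (qfac q p n * qfac (a * q) p n)"
      unfolding pow d by (simp add: mult_ac)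
    finally show "qfac x q (2 * s) * qfac y q (2 * s) * (a * q / (x * y)) ^ (2 * s) / (qfac (a * q / x) q (2 * s) * qfac (a * q / y) q (2 * s)) *
      (quad_alpha q a b (2 * s) / (qfac q q (n + n - 2 * s) * qfac (a * q) q (n + n + 2 * s))) = \<dots>" .
  qed
  finally have VR: "V / (qfac q p n * qfac (a * q) p n) = 
     (\<Sum>j\<le>2 * n. qfac x q j * qfac y q j * (qfac (a * q / (x * y)) q (2 * n - j) * (a * q / (x * y)) ^ j / qfac q q (2 * n - j)) * ?Q j
             / (qfac (a * q / x) q (2 * n) * qfac (a * q / y) q (2 * n)))" ..
  also have "\<dots> = qfac (a * q / (x * y)) q (2 * n) / (qfac q q (2 * n) * qfac (a * q / x) q (2 * n) * qfac (a * q / y) q (2 * n)) * ?S"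
    unfolding sum_distrib_left
  proof (intro sum.cong refl)
    fix j assume "j \<in> {..2 * n}"
    then have j: "j \<le> 2 * n" by simp
    \<comment> \<open>Reversal in base q produces q^(-2n) in the numerator and xy q^(-2n) / a in the
      denominator.\<close>
    have "a * q / (x * y) \<noteq> 0" using a0 x0 y0 q0 by simp
    from qfac_reverse [OF j this q0 qqn nzq(6)]
    have R: "qfac (a * q / (x * y)) q (2 * n - j) * (a * q / (x * y)) ^ j / qfac q q (2 * n - j) =
       qfac (a * q / (x * y)) q (2 * n) / qfac q q (2 * n) *
        (qfac (1 / q ^ (2 * n)) q j * q ^ j / qfac (x * y * (1 / q ^ (2 * n)) / a) q j)"
      using q0 by (simp add: mult.commute [of a])
    show "qfac x q j * qfac y q j * (qfac (a * q / (x * y)) q (2 * n - j) * (a * q / (x * y)) ^ j / qfac q q (2 * n - j)) * ?Q j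
             / (qfac (a * q / x) q (2 * n) * qfac (a * q / y) q (2 * n)) =
      qfac (a * q / (x * y)) q (2 * n) / (qfac q q (2 * n) * qfac (a * q / x) q (2 * n) * qfac (a * q / y) q (2 * n)) *
      ((qfac x q j * qfac y q j * qfac (a * q / b) p j * qfac (1 / q ^ (2 * n)) q j * q ^ j) /
          (qfac q q j * qfac (a * q) p j * qfac (a * q / b) q j * qfac (x * y * (1 / q ^ (2 * n)) / a) q j))"
      unfolding R by (simp add: p_def mult_ac)
  qed
  finally have VS: "V / (qfac q p n * qfac (a * q) p n) =
     qfac (a * q / (x * y)) q (2 * n) / (qfac q q (2 * n) * qfac (a * q / x) q (2 * n) * qfac (a * q / y) q (2 * n)) * ?S" .
  have VL: "V = qfac D3 p n / (qfac p p n * qfac (a * q / y) p n * qfac (a * q * q ^ (2 * n)) p n) * ?L"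
    using bailey_pairD [OF P3, of n] unfolding V_def b3 [symmetric] by simp
  have d2: "qfac q q (2 * n) = qfac q p n * qfac p p n" "qfac (a * q / y) q (2 * n) = qfac (a * q / y) p n * qfac (a * p / y) p n"
    unfolding p_def qfac_double by (simp_all add: power2_eq_square mult_ac)
  have d3: "qfac (a * q) p (2 * n) = qfac (a * q) p n * qfac (a * q * q ^ (2 * n)) p n"
    using qfac_add [of "a * q" p n n] by (simp add: pk mult_2 [of n])
  have nz': "qfac (a * q) p n \<noteq> 0" "qfac (a * q / y) p n \<noteq> 0" "qfac (a * q * q ^ (2 * n)) p n \<noteq> 0"
    using gp [of _ 1 1] gp [of _ "1 / y" 1] gp [of _ 1 "2 * n + 1"] by (simp_all add: mult.assoc)
  \<comment> \<open>The two evaluations of \<open>V\<close> are equated and solved for the double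
    sum \<open>L\<close>, with one letter for each product. Here \<open>D\<close> stands for (D3;
    p)_n, which passes to the denominator, and \<open>A * E\<close> becomes (aq; p)_(2n).\<close>
  have solve: "L = A * E * X / (X1 * (Y2 * D)) * S" 
    if "D / (P * Y1 * E) * L / (Q * A) = X / (Q * P * X1 * (Y1 * Y2)) * S" 
      "D \<noteq> 0" "P \<noteq> 0" "Y1 \<noteq> 0" "E \<noteq> 0" "Q \<noteq> 0" "A \<noteq> 0" for A D E L P Q S X X1 Y1 Y2 :: 'a
  proof -
    have "L = D / (P * Y1 * E) * L / (Q * A) * (P * Y1 * E * Q * A / D)"
      using that(2-) by simp
    also have "\<dots> = A * E * X / (X1 * (Y2 * D)) * S"
      unfolding that(1) using that(2-) by (simp add: mult_ac)
    finally show ?thesis .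
  qed
  show ?thesis
    using solve [OF VS [unfolded VL d2] D3n ppn nz'(2,3) qpn nz'(1)]
    unfolding d3 D3 .
qed

section \<open>Removal of the genericity assumption by continuity in a\<close>

lemma isCont_qfac:
  fixes f :: "complex \<Rightarrow> complex"
  shows "isCont f a \<Longrightarrow> isCont (\<lambda>z. qfac (f z) p n) a"
  unfolding qfac_def by (intro continuous_intros)

lemma isCont_eq_of_eventually_eq:
  fixes f g :: "'a::{perfect_space, t2_space} \<Rightarrow> 'b::t2_space"
  assumes "isCont f a" "isCont g a" "eventually (\<lambda>z. f z = g z) (at a)"
  shows "f a = g a"
proof -
  have "(f \<longlongrightarrow> g a) (at a)"
    using assms(2,3) tendsto_cong [OF assms(3)] by (simp add: isCont_def)
  with assms(1) show ?thesis
    unfolding isCont_def by (rule tendsto_unique [OF at_neq_bot])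
qed

text \<open>At most the point 1 / w is excluded, and it may be \<open>a\<close> itself because the
  filter \<open>at a\<close> is punctured.\<close>

lemma eventually_mult_neq_one:
  fixes a w :: complex
  shows "eventually (\<lambda>z. z * w \<noteq> 1) (at a)"
proof (cases "w = 0")
  case False
  then show ?thesis
    using eventually_neq_at_within [of "1 / w" a UNIV]
    by (elim eventually_mono) (auto simp: field_simps)
qed simp

lemma qpoch_eq_qfac: "qpoch A p (int m) = qfac A p m"
  by (simp add: qfac_def)

text \<open>The exponents 2, 4, ..., 4n - 2 of q are cut after 2n; the additional factor with
  exponent 2n completes the second part to n factors. For n = 0 the convention at index -1 gives the
  reciprocal of this factor, so that both sides are 1.\<close>

lemma qpoch_minus_one_split:
  fixes a y q :: complex
  assumes "q \<noteq> 0" "1 - a * q ^ (2 * n) / y \<noteq> 0"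
  shows "qpoch (a * q\<^sup>2 / y) (q\<^sup>2) (2 * int n - 1) * (1 - a * q ^ (2 * n) / y) =
    qfac (a * q\<^sup>2 / y) (q\<^sup>2) n * qfac (a * q ^ (2 * n) / y) (q\<^sup>2) n"
proof (cases n)
  case 0
  then show ?thesis using assms by (simp add: qpoch_minus_one)
next
  case (Suc k)
  have "2 * int n - 1 = int (Suc k + k)" by (simp add: Suc)
  then have "qpoch (a * q\<^sup>2 / y) (q\<^sup>2) (2 * int n - 1) =
     qfac (a * q\<^sup>2 / y) (q\<^sup>2) (Suc k) * qfac (a * q\<^sup>2 / y * (q\<^sup>2) ^ Suc k) (q\<^sup>2) k"
    by (simp only: qpoch_eq_qfac qfac_add)
  moreover have "qfac (a * q ^ (2 * n) / y) (q\<^sup>2) (1 + k) = 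
     (1 - a * q ^ (2 * n) / y) * qfac (a * q\<^sup>2 / y * (q\<^sup>2) ^ Suc k) (q\<^sup>2) k"
    unfolding qfac_add by (simp add: qfac_Suc Suc power_mult [symmetric] power_add [symmetric] mult_ac)
  ultimately show ?thesis by (simp add: Suc)
qed

theorem theorem2p1:
  fixes n :: nat and q a b x y :: complex
  assumes "q \<noteq> 0" "a \<noteq> 0" "b \<noteq> 0" "x \<noteq> 0" "y \<noteq> 0"
    and "norm q < 1"
    and "\<And>j. j \<le> n \<Longrightarrow>
           qpoch (q^2) (q^2) (int j) \<noteq> 0 \<and>
           qpoch (a * q / x) (q^2) (int j) \<noteq> 0 \<and>
           qpoch (a * q^2 / y) (q^2) (int j) \<noteq> 0 \<and>
           qpoch (y * q powi (2 - 4 * int n) / a) (q^2) (int j) \<noteq> 0"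
    and "\<And>j h. j \<le> n \<Longrightarrow> h \<le> j \<Longrightarrow>
           qpoch (q^2) (q^2) (int h) \<noteq> 0 \<and>
           qpoch (a * q^2 / b) (q^2) (int h) \<noteq> 0 \<and>
           qpoch (a * q^2 / x) (q^2) (int h) \<noteq> 0 \<and>
           qpoch (x * y * q powi (1 - 2 * int j) / a) (q^2) (int h) \<noteq> 0"
    and "qpoch (a * q / x) q (2 * int n) \<noteq> 0"
    and "qpoch (a * q^2 / y) (q^2) (2 * int n - 1) \<noteq> 0"
    and "1 - a * q ^ (2 * n) / y \<noteq> 0"
    and "\<And>j. j \<le> 2 * n \<Longrightarrow>
           qpoch q q (int j) \<noteq> 0 \<and>
           qpoch (a * q) (q^2) (int j) \<noteq> 0 \<and>
           qpoch (a * q / b) q (int j) \<noteq> 0 \<and>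
           qpoch (x * y * q powi (- 2 * int n) / a) q (int j) \<noteq> 0"
  shows
    "(\<Sum>j=0..n. \<Sum>h=0..j.
        (qpoch (q powi (- 2 * int n)) q (2 * int j) *
         qpoch (y * q) (q^2) (int j) *
         qpoch (a * q / (x * y)) (q^2) (int j) *
         qpoch (q powi (- 2 * int j)) (q^2) (int h) *
         qpoch (x * q) (q^2) (int h) *
         qpoch y (q^2) (int h) *
         qpoch (a * q^2 / (b * x)) (q^2) (int h) *
         q ^ (2 * h + 2 * j)) /
        (qpoch (q^2) (q^2) (int j) *
         qpoch (a * q / x) (q^2) (int j) *
         qpoch (a * q^2 / y) (q^2) (int j) *
         qpoch (y * q powi (2 - 4 * int n) / a) (q^2) (int j) *
         qpoch (q^2) (q^2) (int h) *
         qpoch (a * q^2 / b) (q^2) (int h) *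
         qpoch (a * q^2 / x) (q^2) (int h) *
         qpoch (x * y * q powi (1 - 2 * int j) / a) (q^2) (int h)))
     = (qpoch (a * q) (q^2) (2 * int n) * qpoch (a * q / (x * y)) q (2 * int n)) /
       (qpoch (a * q / x) q (2 * int n) *
        qpoch (a * q^2 / y) (q^2) (2 * int n - 1) *
        (1 - a * q ^ (2 * n) / y)) *
       (\<Sum>j=0..2*n.
          (qpoch x q (int j) *
           qpoch y q (int j) *
           qpoch (a * q / b) (q^2) (int j) *
           qpoch (q powi (- 2 * int n)) q (int j) *
           q ^ j) /
          (qpoch q q (int j) *
           qpoch (a * q) (q^2) (int j) *
           qpoch (a * q / b) q (int j) *
           qpoch (x * y * q powi (- 2 * int n) / a) q (int j)))"
proof -
  have pi: "q powi (- 2 * int m) = 1 / q ^ (2 * m)" "q powi (1 - 2 * int m) = q / q ^ (2 * m)"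
    "q powi (2 - 4 * int m) = q\<^sup>2 / q ^ (4 * m)" for m
  proof -
    have "- 2 * int m = - int (2 * m)" by simp
    then show "q powi (- 2 * int m) = 1 / q ^ (2 * m)"
      by (simp only: power_int_minus power_int_of_nat inverse_eq_divide)
    have diff: "q powi (int k - int l) = q ^ k / q ^ l" for k l
      using power_int_diff [of q "int k" "int l"] \<open>q \<noteq> 0\<close> by simp
    show "q powi (1 - 2 * int m) = q / q ^ (2 * m)"
      using diff [of 1 "2 * m"] by simp
    show "q powi (2 - 4 * int m) = q\<^sup>2 / q ^ (4 * m)"
      using diff [of 2 "4 * m"] by simp
  qed
  have qpi: "qpoch A p (2 * int m) = qfac A p (2 * m)" for A p m
    using qpoch_eq_qfac [of A p "2 * m"] by simp
  note conv = pi qpi qpoch_eq_qfac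
  note nz = assms(7-12) [unfolded conv]
  \<comment> \<open>\<open>F\<close> and \<open>G\<close> are the two sides with a variable
    \<open>z\<close> in place of \<open>a\<close>; \<open>G\<close> has the denominator already in
    the form of \<open>qpoch_minus_one_split\<close>.\<close>
  define F where "F = (\<lambda>z. \<Sum>j\<le>n. \<Sum>h\<le>j.
        (qfac (1 / q ^ (2 * n)) q (2 * j) * qfac (y * q) (q\<^sup>2) j * qfac (z * q / (x * y)) (q\<^sup>2) j *
         qfac (1 / q ^ (2 * j)) (q\<^sup>2) h * qfac (x * q) (q\<^sup>2) h * qfac y (q\<^sup>2) h * qfac (z * q\<^sup>2 / (b * x)) (q\<^sup>2) h * q ^ (2 * h + 2 * j)) /
        (qfac (q\<^sup>2) (q\<^sup>2) j * qfac (z * q / x) (q\<^sup>2) j * qfac (z * q\<^sup>2 / y) (q\<^sup>2) j * qfac (y * (q\<^sup>2 / q ^ (4 * n)) / z) (q\<^sup>2) j *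
         qfac (q\<^sup>2) (q\<^sup>2) h * qfac (z * q\<^sup>2 / b) (q\<^sup>2) h * qfac (z * q\<^sup>2 / x) (q\<^sup>2) h * qfac (x * y * (q / q ^ (2 * j)) / z) (q\<^sup>2) h))"
  define G where "G = (\<lambda>z. qfac (z * q) (q\<^sup>2) (2 * n) * qfac (z * q / (x * y)) q (2 * n) /
       (qfac (z * q / x) q (2 * n) * (qfac (z * q\<^sup>2 / y) (q\<^sup>2) n * qfac (z * q ^ (2 * n) / y) (q\<^sup>2) n)) *
     (\<Sum>j\<le>2 * n. (qfac x q j * qfac y q j * qfac (z * q / b) (q\<^sup>2) j * qfac (1 / q ^ (2 * n)) q j * q ^ j) /
          (qfac q q j * qfac (z * q) (q\<^sup>2) j * qfac (z * q / b) q j * qfac (x * y * (1 / q ^ (2 * n)) / z) q j)))"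
  note split = qpoch_minus_one_split [OF assms(1,11)]
  have q1: "q ^ k \<noteq> 1" if "0 < k" for k
    using assms(6) that power_less_one_iff [of "norm q" k]
    by (metis less_irrefl norm_ge_zero norm_one norm_power)
  \<comment> \<open>Finitely many conditions on z, each failing at no more than one point, so the
    generic identity holds in a punctured neighbourhood of \<open>a\<close>.\<close>
  have "eventually (\<lambda>z. \<forall>k\<in>{..4 * n + 4}. \<forall>c\<in>{1, 1 / b, 1 / x, 1 / y, 1 / (x * y)}. z * (c * q ^ k) \<noteq> 1) (at a)"
    by (intro eventually_ball_finite ballI eventually_mult_neq_one) auto
  moreover have "eventually (\<lambda>z. z \<noteq> 0) (at a)"
    by (rule eventually_neq_at_within)
  ultimately have ev: "eventually (\<lambda>z. F z = G z) (at a)"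
  proof eventually_elim
    case (elim z)
    show ?case unfolding F_def G_def
      by (rule double_sum_transformation_generic) (use assms elim q1 in \<open>auto simp: mult.assoc\<close>)
  qed
  \<comment> \<open>Continuity at \<open>a\<close> asks only for the denominators of the theorem
    itself; z also occurs as a divisor inside the products, where a \<noteq> 0 is used.\<close>
  have F: "isCont F a"
    unfolding F_def
    by (intro continuous_sum continuous_at_within_divide continuous_mult continuous_const continuous_ident isCont_qfac)
       (use assms nz(1,2) in auto)
  \<comment> \<open>By \<open>split\<close> the two products of length n in the denominator are
    nonzero, because the factor of index 2n - 1 and 1 - a q^(2n) / y are.\<close>
  have G: "isCont G a"
    unfolding G_def
    by (intro continuous_sum continuous_at_within_divide continuous_mult continuous_const continuous_ident isCont_qfac)
       (use assms nz(3-6) split in \<open>auto simp: mult_eq_0_iff\<close>)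
  have "F a = G a"
    by (rule isCont_eq_of_eventually_eq [OF F G ev])
  then show ?thesis
    unfolding F_def G_def conv split [symmetric] atMost_atLeast0 by (simp add: mult.assoc)
qed

end
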